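(* Let $(\phi^n,R^n)_{n\ge0}$ be generated by the second-order RZF-CN scheme (defined in the context, with $R^0=(F(\phi^0),1)$ and with $\lambda_0,\kappa^{n+1}$ chosen at each step by the rule in the context). Then the scheme is unconditionally energy stable in the sense that, for every $\Delta t>0$ and every $n\ge 0$, $$\widetilde{\mathcal{E}}(\phi^{n+1})-\widetilde{\mathcal{E}}(\phi^{n})\leq-\Delta t(1-\kappa^{n+1})(\mathcal{G}\mu^{n+\frac12},\mu^{n+\frac12})\leq0,$$ where $\widetilde{\mathcal{E}}(\phi^{n})=\frac12(\mathcal{L}\phi^{n},\phi^{n})+R^{n}$. Moreover, with the original energy $\mathcal{E}(\phi^{n})=\frac12(\mathcal{L}\phi^{n},\phi^{n})+(F(\phi^{n}),1)$, one has $$\mathcal{E}(\phi^{n+1})\leq\mathcal{E}(\phi^{n})$$ whenever $\widetilde{R}^{n+1}\geq(F(\phi^{n+1}),1)$, or $\widetilde{R}^{n+1}<(F(\phi^{n+1}),1)$ with $\alpha\geq1$. If $\widetilde{R}^{n+1}<(F(\phi^{n+1}),1)$ and $\alpha\in[0,1)$, then $$\widetilde{\mathcal{E}}(\phi^{n+1})\leq\mathcal{E}(\phi^{n+1}).$$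
   Context: $(\cdot,\cdot)$ is the $L^2(\Omega)$ inner product (e.g. on a periodic domain $\Omega$). $\mathcal{L}$ is a symmetric non-negative linear operator, $\mathcal{G}$ is a positive linear operator in the sense that $(\mathcal{G}v,v)\ge0$ for all $v$ (e.g. $I$ or $-\Delta$), $F$ is a differentiable real function applied pointwise, $(F(\phi),1)=\int_\Omega F(\phi)\,d\mathbf{x}$, and $\Delta t>0$. All functions are assumed regular enough for every expression to be defined. $A=I+\frac12\Delta t\,\mathcal{G}\mathcal{L}$ is invertible. RZF-CN (relaxed zero-factor Crank-Nicolson) scheme: start from $\phi^0$, a given starting function $\phi^{-1}$, and $R^0=(F(\phi^0),1)$. Given $\phi^{n-1},\phi^n$ and $R^n\in\mathbb{R}$, let $\widehat{\phi}^{n+\frac12}=\frac32\phi^n-\frac12\phi^{n-1}$, $\overline{\phi}^{n+1}=A^{-1}[(I-\frac12\Delta t\,\mathcal{G}\mathcal{L})\phi^{n}-\Delta t\,\mathcal{G}F'(\widehat{\phi}^{n+\frac12})]$, $q^{n+1}=-\Delta t\,A^{-1}\mathcal{G}F'(\widehat{\phi}^{n+\frac12})$. Step I: $\phi^{n+1}=\overline{\phi}^{n+1}+\mathcal{P}(\eta^{n+\frac12})q^{n+1}$ and $\widetilde{R}^{n+1}=(F(\overline{\phi}^{n+1}),1)$, where the real number $\mathcal{P}(\eta^{n+\frac12})$ (the zero factor, a linear function of a scalar variable $\eta$) satisfies $\widetilde{R}^{n+1}-R^n=[1+\mathcal{P}(\eta^{n+\frac12})](F'(\widehat{\phi}^{n+\frac12}),\phi^{n+1}-\phi^n)$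 (it is assumed that such a real number exists at each step). Equivalently to the formula for $\phi^{n+1}$, $\frac{\phi^{n+1}-\phi^n}{\Delta t}=-\mathcal{G}\mu^{n+\frac12}$ with $\mu^{n+\frac12}=\frac12\mathcal{L}\phi^{n+1}+\frac12\mathcal{L}\phi^{n}+[1+\mathcal{P}(\eta^{n+\frac12})]F'(\widehat{\phi}^{n+\frac12})$; this is the $\mu^{n+\frac12}$ used. Step II: $R^{n+1}=\lambda_0\widetilde{R}^{n+1}+(1-\lambda_0)(F(\phi^{n+1}),1)$. Choice of $\lambda_0$ and $\kappa^{n+1}$: when $\widetilde{R}^{n+1}\ne(F(\phi^{n+1}),1)$ set $\alpha=\frac{\Delta t(\mathcal{G}\mu^{n+\frac12},\mu^{n+\frac12})}{|\widetilde{R}^{n+1}-(F(\phi^{n+1}),1)|}$. (1) If $\widetilde{R}^{n+1}\geq(F(\phi^{n+1}),1)$, $\lambda_0=0$ and $\kappa^{n+1}=0$. (2) If $\widetilde{R}^{n+1}<(F(\phi^{n+1}),1)$ and $\alpha\geq1$, $\lambda_0=0$ and $\kappa^{n+1}=\frac1\alpha$. (3) If $\widetilde{R}^{n+1}<(F(\phi^{n+1}),1)$ and $\alpha\in[0,1)$, $\lambda_0=1-\alpha$ and $\kappa^{n+1}=1$. *)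

theory Defs
  imports "HOL-Analysis.Analysis"
begin

text \<open>
  Elements of $L^2(\Omega)$ are represented by real functions on the ambient Euclidean space; only
  their values on $\Omega$ up to Lebesgue null sets matter, so equations between functions are
  equations almost everywhere on $\Omega$.
\<close>

definition L2 :: "'a::euclidean_space set \<Rightarrow> ('a \<Rightarrow> real) set" where
  "L2 \<Omega> = {u \<in> borel_measurable (lebesgue_on \<Omega>). integrable (lebesgue_on \<Omega>) (\<lambda>x. (u x)\<^sup>2)}"

definition L2_inner :: "'a::euclidean_space set \<Rightarrow> ('a \<Rightarrow> real) \<Rightarrow> ('a \<Rightarrow> real) \<Rightarrow> real" where
  "L2_inner \<Omega> u v = (LINT x|lebesgue_on \<Omega>. u x * v x)"

definition ae_eq :: "'a::euclidean_space set \<Rightarrow> ('a \<Rightarrow> real) \<Rightarrow> ('a \<Rightarrow> real) \<Rightarrow> bool" where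
  "ae_eq \<Omega> u v \<longleftrightarrow> (AE x in lebesgue_on \<Omega>. u x = v x)"

definition L2_subspace :: "'a::euclidean_space set \<Rightarrow> ('a \<Rightarrow> real) set \<Rightarrow> bool" where
  "L2_subspace \<Omega> V \<longleftrightarrow>
     V \<subseteq> L2 \<Omega> \<and> (\<lambda>x. 0) \<in> V \<and>
     (\<forall>u\<in>V. \<forall>v\<in>V. \<forall>a b. (\<lambda>x. a * u x + b * v x) \<in> V) \<and>
     (\<forall>u\<in>V. \<forall>v. ae_eq \<Omega> u v \<longrightarrow> v \<in> V)"

text \<open>A possibly unbounded linear operator in the function space \<open>H\<close>, with domain \<open>D\<close>.\<close>

definition L2_linear_op ::
  "'a::euclidean_space set \<Rightarrow> ('a \<Rightarrow> real) set \<Rightarrow> ('a \<Rightarrow> real) set \<Rightarrow>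
    (('a \<Rightarrow> real) \<Rightarrow> ('a \<Rightarrow> real)) \<Rightarrow> bool" where
  "L2_linear_op \<Omega> H D T \<longleftrightarrow>
     L2_subspace \<Omega> D \<and> D \<subseteq> H \<and> T ` D \<subseteq> H \<and>
     (\<forall>u\<in>D. \<forall>v\<in>D. ae_eq \<Omega> u v \<longrightarrow> ae_eq \<Omega> (T u) (T v)) \<and>
     (\<forall>u\<in>D. \<forall>v\<in>D. \<forall>a b.
        ae_eq \<Omega> (T (\<lambda>x. a * u x + b * v x)) (\<lambda>x. a * T u x + b * T v x))"

definition L2_symmetric where
  "L2_symmetric \<Omega> D T \<longleftrightarrow> (\<forall>u\<in>D. \<forall>v\<in>D. L2_inner \<Omega> (T u) v = L2_inner \<Omega> u (T v))"

definition L2_nonneg where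
  "L2_nonneg \<Omega> D T \<longleftrightarrow> (\<forall>v\<in>D. L2_inner \<Omega> (T v) v \<ge> 0)"

definition L2_invertible where
  "L2_invertible \<Omega> D H T \<longleftrightarrow>
     (\<forall>g\<in>H. \<exists>u\<in>D. ae_eq \<Omega> (T u) g) \<and>
     (\<forall>u\<in>D. \<forall>v\<in>D. ae_eq \<Omega> (T u) (T v) \<longrightarrow> ae_eq \<Omega> u v)"

text \<open>For an invertible operator the chosen preimage is unique up to null sets.\<close>

definition L2_inverse where
  "L2_inverse \<Omega> D T g = (SOME u. u \<in> D \<and> ae_eq \<Omega> (T u) g)"

text \<open>
  The operator $I + c\,\mathcal{G}\mathcal{L}$ and its natural domain; $A$ is the case
  $c = \Delta t/2$.
\<close>

definition GL_dom :: "('a \<Rightarrow> real) set \<Rightarrow> ('a \<Rightarrow> real) set \<Rightarrow> (('a \<Rightarrow> real) \<Rightarrow> ('a \<Rightarrow> real)) \<Rightarrow> ('a \<Rightarrow> real) set"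
  where "GL_dom D\<^sub>L D\<^sub>G L = {u \<in> D\<^sub>L. L u \<in> D\<^sub>G}"

definition I_plus_GL ::
  "(('a \<Rightarrow> real) \<Rightarrow> ('a \<Rightarrow> real)) \<Rightarrow> (('a \<Rightarrow> real) \<Rightarrow> ('a \<Rightarrow> real)) \<Rightarrow> real \<Rightarrow> ('a \<Rightarrow> real) \<Rightarrow> ('a \<Rightarrow> real)"
  where "I_plus_GL L G c u = (\<lambda>x. u x + c * G (L u) x)"

definition potential :: "'a::euclidean_space set \<Rightarrow> (real \<Rightarrow> real) \<Rightarrow> ('a \<Rightarrow> real) \<Rightarrow> real" where
  "potential \<Omega> F u = L2_inner \<Omega> (\<lambda>x. F (u x)) (\<lambda>x. 1)"

definition energy where
  "energy \<Omega> L F u = 1/2 * L2_inner \<Omega> (L u) u + potential \<Omega> F u"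

definition modified_energy where
  "modified_energy \<Omega> L u r = 1/2 * L2_inner \<Omega> (L u) u + r"

text \<open>
  \<open>H\<close> is the space in which the problem is posed: all of $L^2(\Omega)$, or a smaller space of
  regular functions (for instance smooth periodic ones). Invertibility of $A$ refers to \<open>H\<close>.
\<close>

locale gradient_flow =
  fixes \<Omega> :: "'a::euclidean_space set"
    and H D\<^sub>L D\<^sub>G :: "('a \<Rightarrow> real) set"
    and L G :: "('a \<Rightarrow> real) \<Rightarrow> ('a \<Rightarrow> real)"
    and F :: "real \<Rightarrow> real"
    and dt :: real
  assumes Omega_measurable: "\<Omega> \<in> sets lebesgue"
    and H_subspace: "L2_subspace \<Omega> H"
    and L_linear: "L2_linear_op \<Omega> H D\<^sub>L L"
    and L_symmetric: "L2_symmetric \<Omega> D\<^sub>L L"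
    and L_nonneg: "L2_nonneg \<Omega> D\<^sub>L L"
    and G_linear: "L2_linear_op \<Omega> H D\<^sub>G G"
    and G_nonneg: "L2_nonneg \<Omega> D\<^sub>G G"
    and F_differentiable: "\<And>s. F differentiable (at s)"
    and dt_pos: "dt > 0"
    and A_invertible: "L2_invertible \<Omega> (GL_dom D\<^sub>L D\<^sub>G L) H (I_plus_GL L G (dt / 2))"
begin

abbreviation A_inv :: "('a \<Rightarrow> real) \<Rightarrow> ('a \<Rightarrow> real)" where
  "A_inv \<equiv> L2_inverse \<Omega> (GL_dom D\<^sub>L D\<^sub>G L) (I_plus_GL L G (dt / 2))"

end

text \<open>
  Time levels: \<open>\<phi>m1\<close> is $\phi^{-1}$; \<open>\<phi>hat n\<close>, \<open>\<eta> n\<close> and \<open>\<mu> n\<close> carry the superscript $n+\frac12$;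
  \<open>lam n\<close> and \<open>\<alpha> n\<close> are the values used in the step from $n$ to $n+1$. The quantities
  \<open>\<phi>bar\<close>, \<open>q\<close>, \<open>Rt\<close> and \<open>\<kappa>\<close> only occur at levels $n+1 \ge 1$. The factor \<open>P\<close> is
  allowed to be affine.
\<close>

locale rzf_cn_scheme = gradient_flow \<Omega> H D\<^sub>L D\<^sub>G L G F dt
  for \<Omega> :: "'a::euclidean_space set" and H D\<^sub>L D\<^sub>G L G F dt +
  fixes P :: "real \<Rightarrow> real"
    and \<phi>m1 :: "'a \<Rightarrow> real"
    and \<phi> \<phi>hat \<phi>bar q \<mu> :: "nat \<Rightarrow> 'a \<Rightarrow> real"
    and R Rt \<eta> lam \<alpha> \<kappa> :: "nat \<Rightarrow> real"
  assumes P_linear: "\<exists>a b. \<forall>s. P s = a * s + b"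
    and phi0_regular: "\<phi> 0 \<in> GL_dom D\<^sub>L D\<^sub>G L"
    and F'_regular: "\<And>n. (\<lambda>x. deriv F (\<phi>hat n x)) \<in> D\<^sub>G"
    and F_phi_integrable: "\<And>n. integrable (lebesgue_on \<Omega>) (\<lambda>x. F (\<phi> n x))"
    and F_bar_integrable: "\<And>n. integrable (lebesgue_on \<Omega>) (\<lambda>x. F (\<phi>bar (Suc n) x))"
    and R_0: "R 0 = potential \<Omega> F (\<phi> 0)"
    and hat_eq: "\<And>n. \<phi>hat n =
          (\<lambda>x. 3/2 * \<phi> n x - 1/2 * (case n of 0 \<Rightarrow> \<phi>m1 | Suc m \<Rightarrow> \<phi> m) x)"
    and bar_eq: "\<And>n. ae_eq \<Omega> (\<phi>bar (Suc n))
          (A_inv (\<lambda>x. I_plus_GL L G (- dt / 2) (\<phi> n) x - dt * G (\<lambda>y. deriv F (\<phi>hat n y)) x))"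
    and q_eq: "\<And>n. ae_eq \<Omega> (q (Suc n))
          (\<lambda>x. - dt * A_inv (G (\<lambda>y. deriv F (\<phi>hat n y))) x)"
    and phi_eq: "\<And>n. ae_eq \<Omega> (\<phi> (Suc n)) (\<lambda>x. \<phi>bar (Suc n) x + P (\<eta> n) * q (Suc n) x)"
    and Rt_eq: "\<And>n. Rt (Suc n) = potential \<Omega> F (\<phi>bar (Suc n))"
    and zero_factor: "\<And>n. Rt (Suc n) - R n =
          (1 + P (\<eta> n)) * L2_inner \<Omega> (\<lambda>x. deriv F (\<phi>hat n x)) (\<lambda>x. \<phi> (Suc n) x - \<phi> n x)"
    and mu_eq: "\<And>n. \<mu> n =
          (\<lambda>x. 1/2 * L (\<phi> (Suc n)) x + 1/2 * L (\<phi> n) x + (1 + P (\<eta> n)) * deriv F (\<phi>hat n x))"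
    and R_Suc: "\<And>n. R (Suc n) = lam n * Rt (Suc n) + (1 - lam n) * potential \<Omega> F (\<phi> (Suc n))"
    and alpha_eq: "\<And>n. Rt (Suc n) \<noteq> potential \<Omega> F (\<phi> (Suc n)) \<Longrightarrow>
          \<alpha> n = dt * L2_inner \<Omega> (G (\<mu> n)) (\<mu> n) / \<bar>Rt (Suc n) - potential \<Omega> F (\<phi> (Suc n))\<bar>"
    and choice_1: "\<And>n. Rt (Suc n) \<ge> potential \<Omega> F (\<phi> (Suc n)) \<Longrightarrow> lam n = 0 \<and> \<kappa> (Suc n) = 0"
    and choice_2: "\<And>n. Rt (Suc n) < potential \<Omega> F (\<phi> (Suc n)) \<Longrightarrow> \<alpha> n \<ge> 1 \<Longrightarrow>
          lam n = 0 \<and> \<kappa> (Suc n) = 1 / \<alpha> n"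
    and choice_3: "\<And>n. Rt (Suc n) < potential \<Omega> F (\<phi> (Suc n)) \<Longrightarrow> 0 \<le> \<alpha> n \<Longrightarrow> \<alpha> n < 1 \<Longrightarrow>
          lam n = 1 - \<alpha> n \<and> \<kappa> (Suc n) = 1"

end

theory Submission
  imports Defs
begin

text \<open>
  Applying $A$ to the update formula gives
  $\phi^{n+1}-\phi^n=-\Delta t\,\mathcal{G}\mu^{n+\frac12}$. Taking the inner product with
  $\mu^{n+\frac12}$, the symmetry of $\mathcal{L}$ and the zero-factor equation turn this into the
  energy balance
  \[ \tfrac12(\mathcal{L}\phi^{n+1},\phi^{n+1})-\tfrac12(\mathcal{L}\phi^n,\phi^n)
     +\widetilde R^{n+1}-R^n=-\Delta t(\mathcal{G}\mu^{n+\frac12},\mu^{n+\frac12}). \]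
  The rule for $\lambda_0$ makes $R^{n+1}-\widetilde R^{n+1}$ at most $\kappa^{n+1}$ times the
  dissipation. It also keeps $R^n\le(F(\phi^n),1)$, with equality after every step with
  $\lambda_0=0$; hence the decay of the modified energy passes to the original one.
\<close>

section \<open>The inner product\<close>

lemma ae_eq_sym: "ae_eq \<Omega> u v \<Longrightarrow> ae_eq \<Omega> v u"
  by (auto simp: ae_eq_def elim: eventually_mono)

lemma ae_eq_trans:
  assumes "ae_eq \<Omega> u v" "ae_eq \<Omega> v w"
  shows "ae_eq \<Omega> u w"
  using assms unfolding ae_eq_def by eventually_elim simp

lemma ae_eq_lincomb:
  assumes "ae_eq \<Omega> u u'" "ae_eq \<Omega> v v'"
  shows "ae_eq \<Omega> (\<lambda>x. a * u x + b * v x) (\<lambda>x. a * u' x + b * v' x)"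
  using assms unfolding ae_eq_def by eventually_elim simp

text \<open>The product is dominated by the sum of the squares. Since a non-integrable function has
  Bochner integral 0 by default, this bound is what makes the inner product bilinear on
  \<open>L2\<close>.\<close>

lemma L2_mult_integrable:
  assumes "u \<in> L2 \<Omega>" "v \<in> L2 \<Omega>"
  shows "integrable (lebesgue_on \<Omega>) (\<lambda>x. u x * v x)"
proof (rule Bochner_Integration.integrable_bound)
  show "integrable (lebesgue_on \<Omega>) (\<lambda>x. (u x)\<^sup>2 + (v x)\<^sup>2)"
    using assms by (auto simp: L2_def)
  show "(\<lambda>x. u x * v x) \<in> borel_measurable (lebesgue_on \<Omega>)"
    using assms by (auto simp: L2_def)
  have "\<bar>u x * v x\<bar> \<le> (u x)\<^sup>2 + (v x)\<^sup>2" for x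
    using sum_squares_bound[of "\<bar>u x\<bar>" "\<bar>v x\<bar>"]
      mult_nonneg_nonneg[OF abs_ge_zero[of "u x"] abs_ge_zero[of "v x"]]
    unfolding abs_mult power2_abs by linarith
  then show "AE x in lebesgue_on \<Omega>. norm (u x * v x) \<le> norm ((u x)\<^sup>2 + (v x)\<^sup>2)"
    by simp
qed

lemma L2_inner_commute: "L2_inner \<Omega> u v = L2_inner \<Omega> v u"
  by (simp add: L2_inner_def mult.commute)

lemma L2_inner_lincomb_left:
  assumes "u \<in> L2 \<Omega>" "v \<in> L2 \<Omega>" "w \<in> L2 \<Omega>"
  shows "L2_inner \<Omega> (\<lambda>x. a * u x + b * v x) w = a * L2_inner \<Omega> u w + b * L2_inner \<Omega> v w"
  using L2_mult_integrable[OF assms(1,3)] L2_mult_integrable[OF assms(2,3)]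
  by (simp add: L2_inner_def distrib_right mult.assoc)

lemma L2_inner_lincomb_right:
  assumes "u \<in> L2 \<Omega>" "v \<in> L2 \<Omega>" "w \<in> L2 \<Omega>"
  shows "L2_inner \<Omega> w (\<lambda>x. a * u x + b * v x) = a * L2_inner \<Omega> w u + b * L2_inner \<Omega> w v"
  using L2_inner_lincomb_left[OF assms] by (simp add: L2_inner_commute)

lemma L2_inner_cong_right:
  assumes "u \<in> L2 \<Omega>" "v \<in> L2 \<Omega>" "w \<in> L2 \<Omega>" "ae_eq \<Omega> u v"
  shows "L2_inner \<Omega> w u = L2_inner \<Omega> w v"
  unfolding L2_inner_def
  by (rule integral_cong_AE) (use assms in \<open>auto simp: L2_def ae_eq_def elim: eventually_mono\<close>)

section \<open>Subspaces, operators and inverses modulo null sets\<close>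

lemma L2_subspace_lincomb:
  "L2_subspace \<Omega> V \<Longrightarrow> u \<in> V \<Longrightarrow> v \<in> V \<Longrightarrow> (\<lambda>x. a * u x + b * v x) \<in> V"
  by (simp add: L2_subspace_def)

lemma L2_subspace_ae_closed:
  "L2_subspace \<Omega> V \<Longrightarrow> u \<in> V \<Longrightarrow> ae_eq \<Omega> u v \<Longrightarrow> v \<in> V"
  by (auto simp: L2_subspace_def)

lemma L2_linear_opD:
  assumes "L2_linear_op \<Omega> H D T"
  shows "L2_subspace \<Omega> D"
    and "u \<in> D \<Longrightarrow> u \<in> H"
    and "u \<in> D \<Longrightarrow> T u \<in> H"
    and "u \<in> D \<Longrightarrow> v \<in> D \<Longrightarrow> ae_eq \<Omega> u v \<Longrightarrow> ae_eq \<Omega> (T u) (T v)"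
    and "u \<in> D \<Longrightarrow> v \<in> D \<Longrightarrow>
      ae_eq \<Omega> (T (\<lambda>x. a * u x + b * v x)) (\<lambda>x. a * T u x + b * T v x)"
  using assms by (auto simp: L2_linear_op_def)

text \<open>Surjectivity onto \<open>H\<close> supplies a witness for the \<open>SOME\<close> in the
  definition.\<close>

lemma L2_inverse:
  assumes "L2_invertible \<Omega> D H T" "g \<in> H"
  shows "L2_inverse \<Omega> D T g \<in> D" "ae_eq \<Omega> (T (L2_inverse \<Omega> D T g)) g"
proof -
  have "\<exists>u. u \<in> D \<and> ae_eq \<Omega> (T u) g"
    using assms by (auto simp: L2_invertible_def)
  from someI_ex[OF this]
  show "L2_inverse \<Omega> D T g \<in> D" "ae_eq \<Omega> (T (L2_inverse \<Omega> D T g)) g"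
    by (auto simp: L2_inverse_def)
qed

section \<open>The operator $I + c\,\mathcal{G}\mathcal{L}$\<close>

context gradient_flow
begin

lemma H_subset_L2: "u \<in> H \<Longrightarrow> u \<in> L2 \<Omega>"
  using H_subspace by (auto simp: L2_subspace_def)

lemma GL_dom_D:
  assumes "u \<in> GL_dom D\<^sub>L D\<^sub>G L"
  shows "u \<in> D\<^sub>L" "L u \<in> D\<^sub>G" "u \<in> H" "L u \<in> H" "G (L u) \<in> H"
  using assms L2_linear_opD(2,3)[OF L_linear] L2_linear_opD(3)[OF G_linear]
  by (auto simp: GL_dom_def)

text \<open>Needed because the scheme fixes each new iterate only up to null sets. Both domains are
  closed under a.e. equality, and \<open>L\<close> respects it.\<close>

lemma GL_dom_ae_closed:
  assumes "u \<in> GL_dom D\<^sub>L D\<^sub>G L" "ae_eq \<Omega> u v"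
  shows "v \<in> GL_dom D\<^sub>L D\<^sub>G L"
proof -
  have v: "v \<in> D\<^sub>L"
    using L2_subspace_ae_closed[OF L2_linear_opD(1)[OF L_linear]] GL_dom_D(1) assms by blast
  have "L v \<in> D\<^sub>G"
    using L2_subspace_ae_closed[OF L2_linear_opD(1)[OF G_linear] GL_dom_D(2)[OF assms(1)]]
      L2_linear_opD(4)[OF L_linear GL_dom_D(1)[OF assms(1)] v assms(2)] by blast
  with v show ?thesis by (simp add: GL_dom_def)
qed

lemma
  assumes "u \<in> GL_dom D\<^sub>L D\<^sub>G L" "v \<in> GL_dom D\<^sub>L D\<^sub>G L"
  shows GL_dom_lincomb: "(\<lambda>x. a * u x + b * v x) \<in> GL_dom D\<^sub>L D\<^sub>G L"
    and GL_lincomb: "ae_eq \<Omega> (G (L (\<lambda>x. a * u x + b * v x))) (\<lambda>x. a * G (L u) x + b * G (L v) x)"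
proof -
  let ?w = "\<lambda>x. a * u x + b * v x" and ?Lw = "\<lambda>x. a * L u x + b * L v x"
  have w: "?w \<in> D\<^sub>L"
    using L2_subspace_lincomb[OF L2_linear_opD(1)[OF L_linear]] GL_dom_D(1) assms by blast
  have Lw: "ae_eq \<Omega> (L ?w) ?Lw"
    using L2_linear_opD(5)[OF L_linear] GL_dom_D(1) assms by blast
  have Lw_dom: "?Lw \<in> D\<^sub>G"
    using L2_subspace_lincomb[OF L2_linear_opD(1)[OF G_linear]] GL_dom_D(2) assms by blast
  \<comment> \<open>\<open>L ?w\<close> agrees with the explicit combination only almost everywhere,
    so membership is transferred from \<open>?Lw\<close> before \<open>G\<close> may be
    applied.\<close>
  have dom: "L ?w \<in> D\<^sub>G"
    by (rule L2_subspace_ae_closed[OF L2_linear_opD(1)[OF G_linear] Lw_dom ae_eq_sym[OF Lw]])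
  with w show "?w \<in> GL_dom D\<^sub>L D\<^sub>G L"
    by (simp add: GL_dom_def)
  show "ae_eq \<Omega> (G (L ?w)) (\<lambda>x. a * G (L u) x + b * G (L v) x)"
    by (rule ae_eq_trans[OF L2_linear_opD(4)[OF G_linear dom Lw_dom Lw]
          L2_linear_opD(5)[OF G_linear GL_dom_D(2)[OF assms(1)] GL_dom_D(2)[OF assms(2)]]])
qed

lemma I_plus_GL_in_H:
  assumes "u \<in> GL_dom D\<^sub>L D\<^sub>G L"
  shows "I_plus_GL L G c u \<in> H"
  using L2_subspace_lincomb[OF H_subspace GL_dom_D(3)[OF assms] GL_dom_D(5)[OF assms], of 1 c]
  by (simp add: I_plus_GL_def)

lemma I_plus_GL_cong:
  assumes "u \<in> GL_dom D\<^sub>L D\<^sub>G L" "ae_eq \<Omega> u v"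
  shows "ae_eq \<Omega> (I_plus_GL L G c u) (I_plus_GL L G c v)"
proof -
  note v = GL_dom_ae_closed[OF assms]
  have "ae_eq \<Omega> (L u) (L v)"
    using L2_linear_opD(4)[OF L_linear] GL_dom_D(1) assms v by blast
  then have "ae_eq \<Omega> (G (L u)) (G (L v))"
    using L2_linear_opD(4)[OF G_linear] GL_dom_D(2) assms v by blast
  from ae_eq_lincomb[OF assms(2) this, of 1 c] show ?thesis
    by (simp add: I_plus_GL_def)
qed

lemma I_plus_GL_lincomb:
  assumes "u \<in> GL_dom D\<^sub>L D\<^sub>G L" "v \<in> GL_dom D\<^sub>L D\<^sub>G L"
  shows "ae_eq \<Omega> (I_plus_GL L G c (\<lambda>x. a * u x + b * v x))
           (\<lambda>x. a * I_plus_GL L G c u x + b * I_plus_GL L G c v x)"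
  using GL_lincomb[OF assms, of a b] unfolding ae_eq_def I_plus_GL_def
  by (auto elim!: eventually_mono simp: algebra_simps)

lemma A_inv_in_dom: "g \<in> H \<Longrightarrow> A_inv g \<in> GL_dom D\<^sub>L D\<^sub>G L"
  and A_A_inv: "g \<in> H \<Longrightarrow> ae_eq \<Omega> (I_plus_GL L G (dt / 2) (A_inv g)) g"
  using L2_inverse[OF A_invertible] by auto

end

section \<open>Energy balance\<close>

context rzf_cn_scheme
begin

abbreviation force :: "nat \<Rightarrow> 'a \<Rightarrow> real" where
  "force n \<equiv> (\<lambda>x. deriv F (\<phi>hat n x))"

lemma G_force_in_H: "G (force n) \<in> H"
  using F'_regular L2_linear_opD(3)[OF G_linear] by blast

text \<open>Applying A to the update cancels both inverses. Membership in the domain is proved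
  alongside, so that the step can be iterated.\<close>

lemma phi_step:
  assumes "\<phi> n \<in> GL_dom D\<^sub>L D\<^sub>G L"
  shows "\<phi> (Suc n) \<in> GL_dom D\<^sub>L D\<^sub>G L"
    and "ae_eq \<Omega> (I_plus_GL L G (dt / 2) (\<phi> (Suc n)))
      (\<lambda>x. I_plus_GL L G (- dt / 2) (\<phi> n) x - (1 + P (\<eta> n)) * dt * G (force n) x)"
proof -
  let ?A = "I_plus_GL L G (dt / 2)"
  define g where "g = (\<lambda>x. I_plus_GL L G (- dt / 2) (\<phi> n) x - dt * G (force n) x)"
  have g: "g \<in> H"
    using L2_subspace_lincomb[OF H_subspace I_plus_GL_in_H[OF assms, of "- dt / 2"] G_force_in_H,
        of 1 "- dt"]
    by (simp add: g_def)
  \<comment> \<open>The update with \<open>q\<close> and \<open>\<phi>bar\<close> replaced by their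
    defining formulas: an explicit representative of the new iterate, in the two-term form that
    linearity expects.\<close>
  define w where "w = (\<lambda>x. 1 * A_inv g x + (- P (\<eta> n) * dt) * A_inv (G (force n)) x)"
  have w: "w \<in> GL_dom D\<^sub>L D\<^sub>G L"
    unfolding w_def by (intro GL_dom_lincomb A_inv_in_dom g G_force_in_H)
  have phi_w: "ae_eq \<Omega> w (\<phi> (Suc n))"
    using phi_eq[of n] bar_eq[of n] q_eq[of n] unfolding ae_eq_def w_def g_def
    by eventually_elim (simp add: algebra_simps)
  show "\<phi> (Suc n) \<in> GL_dom D\<^sub>L D\<^sub>G L"
    by (rule GL_dom_ae_closed[OF w phi_w])
  have "ae_eq \<Omega> (?A w)
      (\<lambda>x. 1 * ?A (A_inv g) x + (- P (\<eta> n) * dt) * ?A (A_inv (G (force n))) x)"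
    unfolding w_def by (intro I_plus_GL_lincomb A_inv_in_dom g G_force_in_H)
  with I_plus_GL_cong[OF w phi_w, of "dt / 2"] A_A_inv[OF g] A_A_inv[OF G_force_in_H[of n]]
  show "ae_eq \<Omega> (?A (\<phi> (Suc n)))
      (\<lambda>x. I_plus_GL L G (- dt / 2) (\<phi> n) x - (1 + P (\<eta> n)) * dt * G (force n) x)"
    unfolding ae_eq_def by eventually_elim (simp add: g_def algebra_simps)
qed

lemma phi_in_dom: "\<phi> n \<in> GL_dom D\<^sub>L D\<^sub>G L"
  by (induction n) (auto intro: phi0_regular phi_step)

lemma mu_in_dom: "\<mu> n \<in> D\<^sub>G"
  and G_mu: "ae_eq \<Omega> (G (\<mu> n)) (\<lambda>x. 1/2 * G (L (\<phi> (Suc n))) x + 1/2 * G (L (\<phi> n)) x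
      + (1 + P (\<eta> n)) * G (force n) x)"
proof -
  let ?m = "\<lambda>x. 1/2 * L (\<phi> (Suc n)) x + 1/2 * L (\<phi> n) x"
  note GD = L2_linear_opD(1)[OF G_linear] and G5 = L2_linear_opD(5)[OF G_linear]
  have m: "?m \<in> D\<^sub>G"
    by (intro L2_subspace_lincomb[OF GD] GL_dom_D(2)[OF phi_in_dom])
  have mu: "\<mu> n = (\<lambda>x. 1 * ?m x + (1 + P (\<eta> n)) * force n x)"
    by (simp add: mu_eq)
  show "\<mu> n \<in> D\<^sub>G"
    unfolding mu by (intro L2_subspace_lincomb[OF GD] m F'_regular)
  have "ae_eq \<Omega> (G ?m) (\<lambda>x. 1/2 * G (L (\<phi> (Suc n))) x + 1/2 * G (L (\<phi> n)) x)"
    by (intro G5 GL_dom_D(2)[OF phi_in_dom])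
  moreover have "ae_eq \<Omega> (G (\<mu> n)) (\<lambda>x. 1 * G ?m x + (1 + P (\<eta> n)) * G (force n) x)"
    unfolding mu by (intro G5 m F'_regular)
  ultimately show "ae_eq \<Omega> (G (\<mu> n)) (\<lambda>x. 1/2 * G (L (\<phi> (Suc n))) x + 1/2 * G (L (\<phi> n)) x
      + (1 + P (\<eta> n)) * G (force n) x)"
    unfolding ae_eq_def by eventually_elim simp
qed

text \<open>The \<open>dt / 2\<close> terms at the old and new levels combine into the average of
  \<open>L\<close> inside \<open>\<mu> n\<close>; the direct force and its \<open>P\<close>-multiple
  add up to the factor \<open>1 + P (\<eta> n)\<close>.\<close>

lemma phi_increment:
  "ae_eq \<Omega> (\<lambda>x. \<phi> (Suc n) x - \<phi> n x) (\<lambda>x. - dt * G (\<mu> n) x)"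
  using phi_step(2)[OF phi_in_dom[of n]] G_mu[of n] unfolding ae_eq_def I_plus_GL_def
  by eventually_elim (simp add: algebra_simps)

lemma dissipation_nonneg: "0 \<le> L2_inner \<Omega> (G (\<mu> n)) (\<mu> n)"
  using G_nonneg mu_in_dom by (auto simp: L2_nonneg_def)

lemma energy_balance:
  "1/2 * L2_inner \<Omega> (L (\<phi> (Suc n))) (\<phi> (Suc n)) - 1/2 * L2_inner \<Omega> (L (\<phi> n)) (\<phi> n)
     + Rt (Suc n) - R n = - dt * L2_inner \<Omega> (G (\<mu> n)) (\<mu> n)"
proof -
  let ?u = "\<phi> (Suc n)" and ?v = "\<phi> n"
  define d where "d = (\<lambda>x. 1 * ?u x + (- 1) * ?v x)"
  define m where "m = (\<lambda>x. 1/2 * L ?u x + 1/2 * L ?v x)"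
  have L2s: "?u \<in> L2 \<Omega>" "?v \<in> L2 \<Omega>" "L ?u \<in> L2 \<Omega>" "L ?v \<in> L2 \<Omega>"
    using GL_dom_D[OF phi_in_dom] H_subset_L2 by blast+
  have force: "force n \<in> L2 \<Omega>" and mu: "\<mu> n \<in> L2 \<Omega>" and Gmu: "G (\<mu> n) \<in> H"
    using F'_regular mu_in_dom L2_linear_opD(2,3)[OF G_linear] H_subset_L2 by blast+
  have d: "d \<in> L2 \<Omega>"
    unfolding d_def
    by (intro H_subset_L2 L2_subspace_lincomb[OF H_subspace] GL_dom_D(3)[OF phi_in_dom])
  have m: "m \<in> L2 \<Omega>"
    unfolding m_def
    by (intro H_subset_L2 L2_subspace_lincomb[OF H_subspace] GL_dom_D(4)[OF phi_in_dom])
  \<comment> \<open>The zero term presents a scalar multiple as a two-term combination.\<close>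
  have dG: "(\<lambda>x. - dt * G (\<mu> n) x + 0 * G (\<mu> n) x) \<in> L2 \<Omega>"
    by (intro H_subset_L2 L2_subspace_lincomb[OF H_subspace] Gmu)
  \<comment> \<open>Symmetry cancels the cross terms when the average of \<open>L\<close> is paired
    with the increment, leaving a difference of quadratic forms.\<close>
  have sym: "L2_inner \<Omega> (L ?u) ?v = L2_inner \<Omega> (L ?v) ?u"
    using L_symmetric GL_dom_D(1)[OF phi_in_dom]
    by (simp add: L2_symmetric_def L2_inner_commute[of \<Omega> "L ?v"])
  have "L2_inner \<Omega> (\<mu> n) d = L2_inner \<Omega> (\<mu> n) (\<lambda>x. - dt * G (\<mu> n) x + 0 * G (\<mu> n) x)"
    by (rule L2_inner_cong_right[OF d dG mu]) (use phi_increment[of n] in \<open>simp add: d_def\<close>)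
  also have "\<dots> = - dt * L2_inner \<Omega> (G (\<mu> n)) (\<mu> n)"
    unfolding L2_inner_lincomb_right[OF H_subset_L2[OF Gmu] H_subset_L2[OF Gmu] mu]
    by (simp add: L2_inner_commute)
  finally have diss: "L2_inner \<Omega> (\<mu> n) d = - dt * L2_inner \<Omega> (G (\<mu> n)) (\<mu> n)" .
  have "\<mu> n = (\<lambda>x. 1 * m x + (1 + P (\<eta> n)) * force n x)"
    by (simp add: mu_eq m_def)
  then have "L2_inner \<Omega> (\<mu> n) d = L2_inner \<Omega> m d + (1 + P (\<eta> n)) * L2_inner \<Omega> (force n) d"
    using L2_inner_lincomb_left[OF m force d, of 1 "1 + P (\<eta> n)"] by simp
  \<comment> \<open>The zero factor is chosen precisely so that the nonlinear work equals the change
    from \<open>R n\<close> to the predicted potential.\<close>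
  also have "(1 + P (\<eta> n)) * L2_inner \<Omega> (force n) d = Rt (Suc n) - R n"
    using zero_factor[of n] by (simp add: d_def)
  also have "L2_inner \<Omega> m d = 1/2 * L2_inner \<Omega> (L ?u) ?u - 1/2 * L2_inner \<Omega> (L ?v) ?v"
    unfolding m_def L2_inner_lincomb_left[OF L2s(3,4) d]
    unfolding d_def L2_inner_lincomb_right[OF L2s(1,2,3)] L2_inner_lincomb_right[OF L2s(1,2,4)]
    by (simp add: sym algebra_simps)
  finally show ?thesis
    using diss by simp
qed

section \<open>The choice of the relaxation parameter\<close>

lemma dissipation_eq_alpha:
  assumes "Rt (Suc n) < potential \<Omega> F (\<phi> (Suc n))"
  shows "dt * L2_inner \<Omega> (G (\<mu> n)) (\<mu> n) = \<alpha> n * (potential \<Omega> F (\<phi> (Suc n)) - Rt (Suc n))"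
  using alpha_eq[of n] assms by (auto simp: field_simps)

text \<open>Excludes negative \<open>\<alpha> n\<close>, for which the rule makes no choice; the
  three cases are thus exhaustive.\<close>

lemma alpha_nonneg:
  assumes "Rt (Suc n) < potential \<Omega> F (\<phi> (Suc n))"
  shows "0 \<le> \<alpha> n"
  using alpha_eq[of n] assms dissipation_nonneg[of n] dt_pos by simp

lemma step_cases:
  obtains (above) "Rt (Suc n) \<ge> potential \<Omega> F (\<phi> (Suc n))"
      "lam n = 0" "\<kappa> (Suc n) = 0"
  | (below_large) "Rt (Suc n) < potential \<Omega> F (\<phi> (Suc n))" "\<alpha> n \<ge> 1"
      "lam n = 0" "\<kappa> (Suc n) = 1 / \<alpha> n"
  | (below_small) "Rt (Suc n) < potential \<Omega> F (\<phi> (Suc n))" "0 \<le> \<alpha> n" "\<alpha> n < 1"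
      "lam n = 1 - \<alpha> n" "\<kappa> (Suc n) = 1"
  using choice_1[of n] choice_2[of n] choice_3[of n] alpha_nonneg[of n]
  by (metis not_le)

text \<open>Only the last step matters, so a case distinction replaces induction. Either
  \<open>lam\<close> is 0, or \<open>R\<close> is a convex combination of the potential and a
  smaller value; at level 0 equality is the initial condition.\<close>

lemma R_le_potential: "R n \<le> potential \<Omega> F (\<phi> n)"
proof (cases n)
  case 0
  then show ?thesis by (simp add: R_0)
next
  case (Suc k)
  have "R (Suc k) \<le> potential \<Omega> F (\<phi> (Suc k))"
  proof (cases rule: step_cases[of k])
    case below_small
    have "lam k * Rt (Suc k) \<le> lam k * potential \<Omega> F (\<phi> (Suc k))"
      using below_small by (intro mult_left_mono) auto
    then show ?thesis by (simp add: R_Suc algebra_simps)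
  qed (simp_all add: R_Suc)
  with Suc show ?thesis by simp
qed

lemma kappa_le_1: "\<kappa> (Suc n) \<le> 1"
  by (cases rule: step_cases[of n]) auto

text \<open>Let \<delta> be the potential minus \<open>Rt\<close>. If \<delta> is not positive,
  \<open>R\<close> is the potential, hence at most \<open>Rt\<close>. Otherwise the dissipation is
  \<alpha> times \<delta> and equality holds: \<open>R\<close> exceeds \<open>Rt\<close> by \<delta>
  when \<alpha> is at least 1, and by \<alpha> times \<delta> when it is smaller.\<close>

lemma R_Suc_le:
  "R (Suc n) \<le> Rt (Suc n) + \<kappa> (Suc n) * (dt * L2_inner \<Omega> (G (\<mu> n)) (\<mu> n))"
proof (cases rule: step_cases[of n])
  case above
  then show ?thesis by (simp add: R_Suc)
next
  case below_large
  then show ?thesis by (simp add: R_Suc dissipation_eq_alpha)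
next
  case below_small
  show ?thesis
    unfolding R_Suc dissipation_eq_alpha[OF below_small(1)] below_small(4,5)
    by (simp add: algebra_simps)
qed

section \<open>Decay of the modified and original energies\<close>

lemma modified_energy_decay:
  "modified_energy \<Omega> L (\<phi> (Suc n)) (R (Suc n)) - modified_energy \<Omega> L (\<phi> n) (R n)
     \<le> - dt * (1 - \<kappa> (Suc n)) * L2_inner \<Omega> (G (\<mu> n)) (\<mu> n)"
  using energy_balance[of n] R_Suc_le[of n] by (simp add: modified_energy_def algebra_simps)

lemma modified_decay_nonpos:
  "- dt * (1 - \<kappa> (Suc n)) * L2_inner \<Omega> (G (\<mu> n)) (\<mu> n) \<le> 0"
  using dt_pos kappa_le_1[of n] dissipation_nonneg[of n] by simp

lemma modified_energy_le_energy: "modified_energy \<Omega> L (\<phi> n) (R n) \<le> energy \<Omega> L F (\<phi> n)"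
  using R_le_potential[of n] by (simp add: modified_energy_def energy_def)

text \<open>With \<open>lam n = 0\<close> both energies agree at the new level, while at the old
  level the modified one is the smaller.\<close>

lemma energy_decay:
  assumes "lam n = 0"
  shows "energy \<Omega> L F (\<phi> (Suc n)) \<le> energy \<Omega> L F (\<phi> n)"
proof -
  have "energy \<Omega> L F (\<phi> (Suc n)) = modified_energy \<Omega> L (\<phi> (Suc n)) (R (Suc n))"
    using assms by (simp add: energy_def modified_energy_def R_Suc)
  then show ?thesis
    using modified_energy_decay[of n] modified_decay_nonpos[of n] modified_energy_le_energy[of n]
    by linarith
qed

end

theorem theorem3p2:
  fixes \<Omega> :: "'a::euclidean_space set"
    and H D\<^sub>L D\<^sub>G :: "('a \<Rightarrow> real) set"
    and L G :: "('a \<Rightarrow> real) \<Rightarrow> ('a \<Rightarrow> real)"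
    and F P :: "real \<Rightarrow> real"
    and dt :: real
    and \<phi>m1 :: "'a \<Rightarrow> real"
    and \<phi> \<phi>hat \<phi>bar q \<mu> :: "nat \<Rightarrow> 'a \<Rightarrow> real"
    and R Rt \<eta> lam \<alpha> \<kappa> :: "nat \<Rightarrow> real"
  assumes "rzf_cn_scheme \<Omega> H D\<^sub>L D\<^sub>G L G F dt P \<phi>m1 \<phi> \<phi>hat \<phi>bar q \<mu> R Rt \<eta> lam \<alpha> \<kappa>"
  shows "\<forall>n.
    (modified_energy \<Omega> L (\<phi> (Suc n)) (R (Suc n)) - modified_energy \<Omega> L (\<phi> n) (R n)
        \<le> - dt * (1 - \<kappa> (Suc n)) * L2_inner \<Omega> (G (\<mu> n)) (\<mu> n)
      \<and> - dt * (1 - \<kappa> (Suc n)) * L2_inner \<Omega> (G (\<mu> n)) (\<mu> n) \<le> 0)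
    \<and> (Rt (Suc n) \<ge> potential \<Omega> F (\<phi> (Suc n))
          \<or> (Rt (Suc n) < potential \<Omega> F (\<phi> (Suc n)) \<and> \<alpha> n \<ge> 1)
        \<longrightarrow> energy \<Omega> L F (\<phi> (Suc n)) \<le> energy \<Omega> L F (\<phi> n))
    \<and> (Rt (Suc n) < potential \<Omega> F (\<phi> (Suc n)) \<and> 0 \<le> \<alpha> n \<and> \<alpha> n < 1
        \<longrightarrow> modified_energy \<Omega> L (\<phi> (Suc n)) (R (Suc n)) \<le> energy \<Omega> L F (\<phi> (Suc n)))"
proof -
  interpret rzf_cn_scheme \<Omega> H D\<^sub>L D\<^sub>G L G F dt P \<phi>m1 \<phi> \<phi>hat \<phi>bar q \<mu> R Rt \<eta> lam \<alpha> \<kappa>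
    by fact
  show ?thesis
    \<comment> \<open>In the two cases of the original energy law, the rule gives
      \<open>lam n = 0\<close>, as \<open>energy_decay\<close> requires.\<close>
    by (intro allI conjI impI; (elim disjE conjE)?)
      (use modified_energy_decay modified_decay_nonpos modified_energy_le_energy energy_decay
        choice_1 choice_2 in simp_all)
qed

end
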